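(* Let $\alpha,\sigma>0$ and assume that $\beta\ge2\sqrt\alpha$. Let $U:\mathbb{R}\to\mathbb{R}$ be the unique (up to translations) nontrivial solution to $$u''''-\beta u''+\alpha u=|u|^{2\sigma}u\ \text{ on }\mathbb{R},\qquad \lim_{|t|\to\infty}(u,u',u'',u''')(t)=(0,0,0,0).$$ If $v$ solves the linearized equation around $U$, $$v''''-\beta v''+\alpha v=(2\sigma+1)|U|^{2\sigma}v\ \text{ on }\mathbb{R},$$ and $\lim_{|t|\to\infty}(v,v',v'',v''')(t)=(0,0,0,0)$, then $v\in\langle U'\rangle$, i.e. $v$ is a scalar multiple of $U'$.
   Context: It is known that the nontrivial homoclinic solution $U$ is unique up to translations (and multiplication by $-1$) when $\beta\ge2\sqrt\alpha$. *)

theory Defs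
  imports "HOL-Analysis.Analysis"
begin

text \<open>\<open>deriv\<close> is total, so the existence of the four derivatives has to be required explicitly.\<close>

definition four_times_differentiable :: "(real \<Rightarrow> real) \<Rightarrow> bool" where
  "four_times_differentiable u \<longleftrightarrow>
     (\<forall>k<4. \<forall>t. (deriv ^^ k) u field_differentiable (at t))"

text \<open>For real arguments \<open>at_infinity\<close> is the filter \<open>\<bar>t\<bar> \<rightarrow> \<infinity>\<close>.\<close>

definition homoclinic_to_zero :: "(real \<Rightarrow> real) \<Rightarrow> bool" where
  "homoclinic_to_zero u \<longleftrightarrow>
     ((\<lambda>t. (u t, deriv u t, (deriv ^^ 2) u t, (deriv ^^ 3) u t)) \<longlongrightarrow> (0, 0, 0, 0)) at_infinity"

text \<open>Both equations below determine the fourth derivative as a continuous function of \<open>t\<close>,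
  so their solutions are automatically of class \<open>C\<^sup>4\<close>. Moreover \<open>0 powr (2 * \<sigma>) = 0\<close>, which is
  the intended value of the nonlinearity for \<open>\<sigma> > 0\<close>.\<close>

definition solves_nonlinear_eq :: "real \<Rightarrow> real \<Rightarrow> real \<Rightarrow> (real \<Rightarrow> real) \<Rightarrow> bool" where
  "solves_nonlinear_eq \<alpha> \<beta> \<sigma> u \<longleftrightarrow>
     four_times_differentiable u \<and>
     (\<forall>t. (deriv ^^ 4) u t - \<beta> * (deriv ^^ 2) u t + \<alpha> * u t = \<bar>u t\<bar> powr (2 * \<sigma>) * u t)"

definition solves_linearized_eq ::
    "real \<Rightarrow> real \<Rightarrow> real \<Rightarrow> (real \<Rightarrow> real) \<Rightarrow> (real \<Rightarrow> real) \<Rightarrow> bool" where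
  "solves_linearized_eq \<alpha> \<beta> \<sigma> U v \<longleftrightarrow>
     four_times_differentiable v \<and>
     (\<forall>t. (deriv ^^ 4) v t - \<beta> * (deriv ^^ 2) v t + \<alpha> * v t
          = (2 * \<sigma> + 1) * \<bar>U t\<bar> powr (2 * \<sigma>) * v t)"

end

theory Submission
  imports Defs
begin

text \<open>Let \<open>l, m > 0\<close> be the roots of \<open>x\<^sup>2 - \<beta> x + \<alpha>\<close>. With \<open>z = u'' - l u\<close> an equation
  \<open>u'''' - \<beta> u'' + \<alpha> u = c u + p\<close> with \<open>c, p \<ge> 0\<close> becomes the cooperative system
  \<open>u'' = l u + z\<close>, \<open>z'' = m z + c u + p\<close>: if \<open>u, u', z, z'\<close> are all nonnegative at some time, they
  are nondecreasing afterwards, so a decaying solution vanishes from then on.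

  Together with the vanishing of the energy, this cone argument shows that \<open>U\<close> has no zero, say
  \<open>U > 0\<close>. Applied to \<open>U\<close> minus its reflection it shows that \<open>U\<close> is even about a maximum point \<open>a\<close>,
  and applied to \<open>U'\<close> that \<open>U''(a) < 0\<close>. Now subtract from \<open>v\<close> a multiple of \<open>U'\<close> such that
  \<open>v'(a) = 0\<close>; then \<open>v\<close> is even about \<open>a\<close> too. If \<open>v(a) > 0\<close>, the cone argument for \<open>v - k U\<close> with
  \<open>k = v(a) / U(a)\<close>, where the superlinearity of \<open>f(x) = x\<^bsup>2\<sigma>+1\<^esup>\<close> gives \<open>p > 0\<close>, yields
  \<open>v''(a) U(a) < v(a) U''(a)\<close>. The energy and its linearization, evaluated at \<open>a\<close>, turn this into
  \<open>f(U) U < 2 F(U)\<close> with \<open>F\<close> the primitive of \<open>f\<close>, which is false. Hence \<open>v(a) = 0\<close>, and a last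
  application of the cone argument gives \<open>v = 0\<close>.\<close>

subsection \<open>Jets and the cone argument\<close>

text \<open>Before the first time at which some component is nonpositive, all components are
  positive. Up to that time the offending component is nondecreasing, so it cannot have lost its
  positive initial value.\<close>

lemma orthant_invariant:
  fixes x d :: "nat \<Rightarrow> real \<Rightarrow> real"
  assumes der: "\<And>i t. i < n \<Longrightarrow> (x i has_real_derivative d i t) (at t)"
    and inward: "\<And>i t. i < n \<Longrightarrow> a \<le> t \<Longrightarrow> (\<And>j. j < n \<Longrightarrow> 0 \<le> x j t) \<Longrightarrow> 0 \<le> d i t"
    and start: "\<And>i. i < n \<Longrightarrow> 0 < x i a"
    and "i < n" "a \<le> t"
  shows "0 < x i t"
proof (rule ccontr)
  assume neg: "\<not> 0 < x i t"
  define S where "S = (\<Union>j<n. {s \<in> {a..t}. x j s \<le> 0})"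
  have cont: "continuous_on A (x j)" if "j < n" for j A
    using der[OF that] by (meson DERIV_continuous_on has_field_derivative_at_within)
  have "closed {s \<in> {a..t}. x j s \<le> 0}" if "j < n" for j
    by (rule continuous_on_closed_Collect_le) (auto intro: cont that)
  then have "closed S" unfolding S_def by (intro closed_UN) auto
  moreover have "t \<in> S" using neg assms(4,5) unfolding S_def by force
  moreover have bdd: "bdd_below S" unfolding S_def by (rule bdd_belowI[of _ a]) auto
  ultimately have "Inf S \<in> S" by (intro closed_contains_Inf) auto
  then obtain j where j: "j < n" "a \<le> Inf S" "Inf S \<le> t" "x j (Inf S) \<le> 0"
    unfolding S_def by auto
  have pos: "0 < x k s" if "k < n" "a \<le> s" "s < Inf S" for k s
  proof (rule ccontr)
    assume "\<not> 0 < x k s"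
    then have "s \<in> S" using that j unfolding S_def by force
    then show False using cInf_lower[OF _ bdd] that by force
  qed
  have "x j a \<le> x j (Inf S)"
  proof (rule DERIV_nonneg_imp_increasing_open[OF j(2)])
    fix s assume s: "a < s" "s < Inf S"
    have "0 \<le> x k s" if "k < n" for k using pos[of k s] that s by simp
    then have "0 \<le> d j s" using inward[of j s] j s by auto
    then show "\<exists>y. DERIV (x j) s :> y \<and> 0 \<le> y" using der j by blast
  qed (rule cont[OF j(1)])
  then show False using start[OF j(1)] j(4) by simp
qed

text \<open>\<open>u k\<close> stands for the \<open>k\<close>-th derivative, with \<open>\<beta> = l + m\<close> and \<open>\<alpha> = l * m\<close>.\<close>

definition jet_solves :: "real \<Rightarrow> real \<Rightarrow> (real \<Rightarrow> real) \<Rightarrow> (nat \<Rightarrow> real \<Rightarrow> real) \<Rightarrow> bool" where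
  "jet_solves l m g u \<longleftrightarrow>
     (\<forall>t. \<forall>k<3. (u k has_real_derivative u (Suc k) t) (at t)) \<and>
     (\<forall>t. (u 3 has_real_derivative (l + m) * u 2 t - l * m * u 0 t + g t) (at t))"

definition decays :: "(nat \<Rightarrow> real \<Rightarrow> real) \<Rightarrow> bool" where
  "decays u \<longleftrightarrow> (\<forall>k<4. (u k \<longlongrightarrow> 0) at_infinity)"

text \<open>The sign \<open>(-1) ^ k\<close> makes this the jet of the time-reversed function
  \<open>u 0 (2 * a - t)\<close>.\<close>

definition reflect :: "real \<Rightarrow> (nat \<Rightarrow> real \<Rightarrow> real) \<Rightarrow> nat \<Rightarrow> real \<Rightarrow> real" where
  "reflect a u k t = (-1) ^ k * u k (2 * a - t)"

lemma jet_solvesD: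
  assumes "jet_solves l m g u"
  shows "(u 0 has_real_derivative u 1 t) (at t)" "(u 1 has_real_derivative u 2 t) (at t)"
    "(u 2 has_real_derivative u 3 t) (at t)"
    "(u 3 has_real_derivative (l + m) * u 2 t - l * m * u 0 t + g t) (at t)"
  using assms unfolding jet_solves_def by (force simp: eval_nat_numeral)+

lemma jet_solvesI:
  assumes "\<And>t. (u 0 has_real_derivative u 1 t) (at t)" "\<And>t. (u 1 has_real_derivative u 2 t) (at t)"
    "\<And>t. (u 2 has_real_derivative u 3 t) (at t)"
    "\<And>t. (u 3 has_real_derivative (l + m) * u 2 t - l * m * u 0 t + g t) (at t)"
  shows "jet_solves l m g u"
  using assms unfolding jet_solves_def by (auto simp: eval_nat_numeral less_Suc_eq)

lemma all_less_4: "(\<forall>k<4::nat. P k) \<longleftrightarrow> P 0 \<and> P 1 \<and> P 2 \<and> P 3"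
  by (auto simp: eval_nat_numeral less_Suc_eq)

text \<open>Keeps \<open>u 1\<close> from being rewritten to \<open>u (Suc 0)\<close>.\<close>

declare One_nat_def [simp del]

lemma decaysD:
  assumes "decays u"
  shows "(u 0 \<longlongrightarrow> 0) at_infinity" "(u 1 \<longlongrightarrow> 0) at_infinity"
    "(u 2 \<longlongrightarrow> 0) at_infinity" "(u 3 \<longlongrightarrow> 0) at_infinity"
  using assms unfolding decays_def by auto

section \<open>Linear combinations and reflections of jets\<close>

lemma jet_solves_lincomb:
  assumes "jet_solves l m g u" "jet_solves l m h v"
  shows "jet_solves l m (\<lambda>t. a * g t + b * h t) (\<lambda>k t. a * u k t + b * v k t)"
  by (rule jet_solvesI)
    (auto intro!: derivative_eq_intros jet_solvesD[OF assms(1)] jet_solvesD[OF assms(2)]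
      simp: algebra_simps)

lemma decays_lincomb:
  assumes "decays u" "decays v"
  shows "decays (\<lambda>k t. a * u k t + b * v k t)"
  using assms unfolding decays_def by (auto intro!: tendsto_eq_intros)

lemma jet_solves_uminus:
  assumes "jet_solves l m g u"
  shows "jet_solves l m (\<lambda>t. - g t) (\<lambda>k t. - u k t)"
  using jet_solves_lincomb[OF assms assms, of "-1" 0] by simp

lemma decays_uminus: "decays u \<Longrightarrow> decays (\<lambda>k t. - u k t)"
  using decays_lincomb[of u u "-1" 0] by simp

text \<open>Only derivatives of even order occur in the equation, so time reversal preserves
  it.\<close>

lemma jet_solves_reflect:
  assumes "jet_solves l m g u"
  shows "jet_solves l m (\<lambda>t. g (2 * a - t)) (reflect a u)"
proof -
  have chain: "((\<lambda>t. f (2 * a - t)) has_real_derivative - f') (at t)"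
    if "(f has_real_derivative f') (at (2 * a - t))" for f f' t
  proof -
    have "((\<lambda>t. 2 * a - t) has_real_derivative -1) (at t)"
      by (auto intro!: derivative_eq_intros)
    from DERIV_chain2[OF that this] show ?thesis by simp
  qed
  show ?thesis
    by (rule jet_solvesI)
      (auto simp: reflect_def[abs_def] intro!: derivative_eq_intros chain jet_solvesD[OF assms])
qed

lemma decays_reflect:
  assumes "decays u"
  shows "decays (reflect a u)"
proof -
  have "filterlim (\<lambda>t::real. 2 * a - t) at_infinity at_infinity"
  proof -
    have "filterlim (\<lambda>t. 2 * a + - t) at_infinity (at_infinity :: real filter)"
      by (rule tendsto_add_filterlim_at_infinity[OF tendsto_const])
        (simp only: filterlim_at_infinity_conv_norm_at_top norm_minus_cancel filterlim_norm_at_top)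
    then show ?thesis by simp
  qed
  from filterlim_compose[OF _ this] assms show ?thesis
    unfolding decays_def reflect_def by (auto intro!: tendsto_mult_right_zero)
qed

text \<open>The condition on \<open>g\<close> is a form of nonnegativity on the cone that survives
  the shift by \<open>e\<close>; at \<open>e = 0\<close> it gives \<open>0 \<le> g t\<close>
  wherever \<open>0 \<le> u 0 t\<close>. The cone components are then nonnegative, nondecreasing and
  tend to 0, hence vanish.\<close>

lemma decays_cone_trivial:
  fixes u :: "nat \<Rightarrow> real \<Rightarrow> real"
  assumes lm: "0 < l" "0 < m" and M: "0 \<le> M"
    and sol: "jet_solves l m g u" and dec: "decays u"
    and g: "\<And>t e. 0 \<le> e \<Longrightarrow> 0 \<le> u 0 t + e \<Longrightarrow> 0 \<le> g t + M * e"
    and start: "0 \<le> u 0 a" "0 \<le> u 1 a" "0 \<le> u 2 a - l * u 0 a" "0 \<le> u 3 a - l * u 1 a"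
  shows "\<And>t k. a \<le> t \<Longrightarrow> k < 4 \<Longrightarrow> u k t = 0" and "\<And>t. a < t \<Longrightarrow> g t = 0"
proof -
  \<comment> \<open>\<open>X\<close> lists \<open>u\<close>, \<open>u'\<close>, \<open>z\<close>,
    \<open>z'\<close> with \<open>z = u'' - l u\<close>, and \<open>Y\<close> their derivatives; the
    last one is \<open>z'' = m z + g\<close>.\<close>
  define X where "X = (\<lambda>k t. if k < 2 then u k t else u k t - l * u (k - 2) t)"
  define Y where "Y = (\<lambda>k t. [u 1 t, u 2 t, u 3 t - l * u 1 t, m * (u 2 t - l * u 0 t) + g t] ! k)"
  have X: "X 0 = u 0" "X 1 = u 1" "X 2 = (\<lambda>t. u 2 t - l * u 0 t)" "X 3 = (\<lambda>t. u 3 t - l * u 1 t)"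
    by (auto simp: X_def One_nat_def)
  have "\<forall>k<4. \<forall>t. (X k has_real_derivative Y k t) (at t)"
    unfolding all_less_4 X
    by (auto simp: Y_def algebra_simps intro!: derivative_eq_intros jet_solvesD[OF sol])
  then have der: "(X k has_real_derivative Y k t) (at t)" if "k < 4" for k t using that by blast
  define K where "K = 1 + l + m + M"
  \<comment> \<open>The exponential shift makes the initial data strictly positive; \<open>K\<close> exceeds all row sums,
    so the shifted functions still satisfy the inequalities of the system.\<close>
  have shifted: "0 < X k t + e * exp (K * (t - a))" if "k < 4" "a \<le> t" "0 < e" for k t e
  proof (rule orthant_invariant[of 4 "\<lambda>k t. X k t + e * exp (K * (t - a))"
        "\<lambda>k t. Y k t + K * (e * exp (K * (t - a)))" a])
    fix k t assume "k < (4::nat)"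
    then show "((\<lambda>t. X k t + e * exp (K * (t - a))) has_real_derivative
        Y k t + K * (e * exp (K * (t - a)))) (at t)"
      by (auto intro!: derivative_eq_intros der)
  next
    fix k t assume k: "k < (4::nat)" and pos: "\<And>j. j < 4 \<Longrightarrow> 0 \<le> X j t + e * exp (K * (t - a))"
    define E where "E = e * exp (K * (t - a))"
    have E: "0 < E" using \<open>0 < e\<close> unfolding E_def by simp
    have p: "0 \<le> u 0 t + E" "0 \<le> u 1 t + E" "0 \<le> u 2 t - l * u 0 t + E" "0 \<le> u 3 t - l * u 1 t + E"
      using pos[of 0] pos[of 1] pos[of 2] pos[of 3] unfolding X E_def by auto
    have q: "0 \<le> l * (u 0 t + E)" "0 \<le> m * (u 2 t - l * u 0 t + E)" "0 \<le> g t + M * E"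
      "0 \<le> l * E" "0 \<le> m * E" "0 \<le> M * E"
      using p E lm M g[of E t] by auto
    have "\<forall>k<4. 0 \<le> Y k t + K * E"
      unfolding all_less_4 using p q E by (auto simp: Y_def K_def algebra_simps)
    then show "0 \<le> Y k t + K * (e * exp (K * (t - a)))" using k unfolding E_def by blast
  next
    fix k assume "k < (4::nat)"
    moreover have "\<forall>k<4. 0 \<le> X k a" unfolding all_less_4 X using start by auto
    ultimately show "0 < X k a + e * exp (K * (a - a))" using \<open>0 < e\<close> by (auto intro: add_nonneg_pos)
  qed (use that in auto)
  have nonneg: "0 \<le> X k t" if "k < 4" "a \<le> t" for k t
  proof (rule field_le_epsilon)
    fix e :: real assume "0 < e"
    then show "0 \<le> X k t + e"
      using shifted[OF that, of "e / exp (K * (t - a))"] by simp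
  qed
  have "\<forall>k<4. 0 \<le> Y k t" if "a \<le> t" for t
  proof -
    have "\<forall>k<4. 0 \<le> X k t" using nonneg that by blast
    then have p: "0 \<le> u 0 t" "0 \<le> u 1 t" "0 \<le> u 2 t - l * u 0 t" "0 \<le> u 3 t - l * u 1 t"
      unfolding all_less_4 X by auto
    then have q: "0 \<le> l * u 0 t" "0 \<le> m * (u 2 t - l * u 0 t)" "0 \<le> g t"
      using lm g[of 0 t] by auto
    show ?thesis unfolding all_less_4 using p q by (simp add: Y_def)
  qed
  then have mono: "X k s \<le> X k t" if "k < 4" "a \<le> s" "s \<le> t" for k s t
    using that by (intro DERIV_nonneg_imp_nondecreasing[OF that(3)]) (meson der order_trans)
  have "\<forall>k<4. (X k \<longlongrightarrow> 0) at_infinity"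
    unfolding all_less_4 X by (auto intro!: tendsto_eq_intros decaysD[OF dec])
  then have lim: "(X k \<longlongrightarrow> 0) at_top" if "k < 4" for k
    using that by (meson at_top_le_at_infinity tendsto_mono)
  have "X k t \<le> 0" if "k < 4" "a \<le> t" for k t
    using tendsto_lowerbound[OF lim[OF that(1)], of "X k t"] mono[OF that]
    by (auto simp: eventually_at_top_linorder)
  then have zero: "\<forall>k<4. X k t = 0" if "a \<le> t" for t
    using nonneg that by (meson antisym)
  have "\<forall>k<4. u k t = 0" if "a \<le> t" for t
    using zero[OF that] unfolding all_less_4 X by auto
  then show u: "u k t = 0" if "a \<le> t" "k < 4" for t k using that by blast
  \<comment> \<open>To the right of \<open>a\<close> the function \<open>u 3\<close> is identically
    0, so its derivative is 0 and the equation leaves only \<open>g t\<close>. At \<open>a\<close>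
    itself nothing is known about the left side.\<close>
  show "g t = 0" if "a < t" for t
  proof -
    have "((\<lambda>t. 0) has_real_derivative (l + m) * u 2 t - l * m * u 0 t + g t) (at t)"
      by (rule has_field_derivative_transform_within_open[OF jet_solvesD(4)[OF sol], of "{a<..}"])
        (use that u in auto)
    from DERIV_unique[OF this DERIV_const] u[of t 0] u[of t 2] that show ?thesis by simp
  qed
qed

lemma decays_first_integral_zero:
  fixes E :: "real \<Rightarrow> real"
  assumes "\<And>t. (E has_real_derivative 0) (at t)" "(E \<longlongrightarrow> 0) at_infinity"
  shows "E t = 0"
proof -
  have "E = (\<lambda>_. E t)" using DERIV_isconst_all[of E] assms(1) by blast
  then have "((\<lambda>_. E t) \<longlongrightarrow> 0) (at_top :: real filter)"
    using assms(2) by (metis at_top_le_at_infinity tendsto_mono)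
  then show ?thesis by (simp add: tendsto_const_iff)
qed

text \<open>From \<open>- e \<le> u 0 t\<close> follows \<open>- M * e \<le> c t * u 0 t\<close>,
  which is the condition of the cone argument. The vanishing of \<open>p\<close> yields a
  contradiction wherever \<open>p\<close> is known to be positive.\<close>

lemma decays_linear_cone_trivial:
  assumes "0 < l" "0 < m" and c: "\<And>t. 0 \<le> c t" "\<And>t. c t \<le> M" and p: "\<And>t. 0 \<le> p t"
    and "jet_solves l m (\<lambda>t. c t * u 0 t + p t) u" "decays u"
    and "0 \<le> u 0 a" "0 \<le> u 1 a" "0 \<le> u 2 a - l * u 0 a" "0 \<le> u 3 a - l * u 1 a"
  shows "\<And>t k. a \<le> t \<Longrightarrow> k < 4 \<Longrightarrow> u k t = 0" and "\<And>t. a < t \<Longrightarrow> p t = 0"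
proof -
  have M: "0 \<le> M" using c[of 0] by linarith
  have g: "0 \<le> c t * u 0 t + p t + M * e" if "0 \<le> e" "0 \<le> u 0 t + e" for t e
  proof -
    have "0 \<le> c t * (u 0 t + e)" "0 \<le> (M - c t) * e" using that c[of t] by auto
    then show ?thesis using p[of t] by (simp add: algebra_simps)
  qed
  note cone = decays_cone_trivial[OF assms(1,2) M assms(6,7) g assms(8-11)]
  show *: "u k t = 0" if "a \<le> t" "k < 4" for k t using cone(1) that by blast
  show "p t = 0" if "a < t" for t using cone(2)[OF _ _ that] *[of t 0] that by simp
qed

text \<open>By linearity the opposite cone serves as well. In particular a jet at \<open>a\<close>
  whose only nonzero entry is \<open>u 2 a\<close> or \<open>u 3 a\<close> always lies in one of the
  two cones.\<close>

lemma decays_homogeneous_cone_trivial: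
  assumes lm: "0 < l" "0 < m" and c: "\<And>t. 0 \<le> c t" "\<And>t. c t \<le> M"
    and sol: "jet_solves l m (\<lambda>t. c t * u 0 t) u" and dec: "decays u"
    and start: "0 \<le> u 0 a \<and> 0 \<le> u 1 a \<and> 0 \<le> u 2 a - l * u 0 a \<and> 0 \<le> u 3 a - l * u 1 a \<or>
      u 0 a \<le> 0 \<and> u 1 a \<le> 0 \<and> u 2 a - l * u 0 a \<le> 0 \<and> u 3 a - l * u 1 a \<le> 0"
    and t: "a \<le> t" "k < 4"
  shows "u k t = 0"
  using start
proof
  assume "0 \<le> u 0 a \<and> 0 \<le> u 1 a \<and> 0 \<le> u 2 a - l * u 0 a \<and> 0 \<le> u 3 a - l * u 1 a"
  then show ?thesis
    using sol dec t by (intro decays_linear_cone_trivial(1)[OF lm c, where p = "\<lambda>_. 0"]) auto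
next
  assume "u 0 a \<le> 0 \<and> u 1 a \<le> 0 \<and> u 2 a - l * u 0 a \<le> 0 \<and> u 3 a - l * u 1 a \<le> 0"
  then have "- u k t = 0"
    using jet_solves_uminus[OF sol] decays_uminus[OF dec] t
    by (intro decays_linear_cone_trivial(1)[OF lm c,
          where p = "\<lambda>_. 0" and u = "\<lambda>k t. - u k t"]) auto
  then show ?thesis by simp
qed

text \<open>The zero jet lies in the cone, which gives vanishing after \<open>a\<close>; the
  reflected jet gives vanishing before \<open>a\<close>.\<close>

lemma linear_unique_continuation:
  assumes lm: "0 < l" "0 < m" and c: "\<And>t. 0 \<le> c t" "\<And>t. c t \<le> M"
    and sol: "jet_solves l m (\<lambda>t. c t * u 0 t) u" and dec: "decays u"
    and zero: "\<And>k. k < 4 \<Longrightarrow> u k a = 0"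
  shows "u 0 t = 0"
proof (cases "a \<le> t")
  case True
  show ?thesis
    by (rule decays_homogeneous_cone_trivial[OF lm c sol dec, of a]) (simp_all add: zero True)
next
  case False
  have "jet_solves l m (\<lambda>t. c (2 * a - t) * reflect a u 0 t) (reflect a u)"
    using jet_solves_reflect[OF sol, of a] by (simp add: reflect_def)
  then have "reflect a u 0 (2 * a - t) = 0"
    by (rule decays_homogeneous_cone_trivial[where c = "\<lambda>t. c (2 * a - t)" and a = a,
        OF lm c(1) c(2) _ decays_reflect[OF dec]])
      (use False in \<open>simp_all add: zero reflect_def\<close>)
  then show ?thesis by (simp add: reflect_def)
qed

subsection \<open>Zeros and the peak of a homoclinic solution\<close>

text \<open>Outside a compact interval \<open>f\<close> stays below \<open>f p\<close>, so the
  maximum over that interval is global.\<close>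

lemma decaying_attains_max:
  fixes f :: "real \<Rightarrow> real"
  assumes "continuous_on UNIV f" "(f \<longlongrightarrow> 0) at_infinity" "0 < f p"
  shows "\<exists>a. \<forall>t. f t \<le> f a"
proof -
  have "eventually (\<lambda>t. f t < f p) at_infinity" using order_tendstoD(2)[OF assms(2,3)] .
  then obtain R where R: "\<And>t. R \<le> \<bar>t\<bar> \<Longrightarrow> f t < f p" unfolding eventually_at_infinity by auto
  then have p: "p \<in> {-R..R}" using less_irrefl[of "f p"] by force
  then obtain a where a: "a \<in> {-R..R}" "\<And>t. t \<in> {-R..R} \<Longrightarrow> f t \<le> f a"
    using continuous_attains_sup[of "{-R..R}" f] continuous_on_subset[OF assms(1)] by blast
  have "f t \<le> f a" for t
  proof (cases "t \<in> {-R..R}")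
    case False
    then have "f t < f p" by (intro R) auto
    then show ?thesis using a(2)[OF p] by simp
  qed (use a in auto)
  then show ?thesis by blast
qed

lemma decaying_bounded:
  fixes f :: "real \<Rightarrow> real"
  assumes "continuous_on UNIV f" "(f \<longlongrightarrow> 0) at_infinity"
  shows "\<exists>B>0. \<forall>t. \<bar>f t\<bar> \<le> B"
proof (cases "\<exists>p. f p \<noteq> 0")
  case True
  then obtain p where "f p \<noteq> 0" by blast
  then have "\<exists>a. \<forall>t. \<bar>f t\<bar> \<le> \<bar>f a\<bar>"
    using assms by (intro decaying_attains_max[of _ p]) (auto intro: continuous_intros tendsto_rabs_zero)
  then show ?thesis using \<open>f p \<noteq> 0\<close> by (metis abs_ge_zero abs_le_zero_iff less_eq_real_def)
qed (auto intro: exI[of _ 1])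

text \<open>At 0 Caratheodory's criterion applies: the function factors as
  \<open>\<bar>z\<bar> powr (2 * s) * z\<close> times \<open>z\<close>, and the first factor is
  continuous and vanishes at 0.\<close>

lemma DERIV_abs_powr:
  fixes s x :: real
  assumes "0 < s"
  shows "((\<lambda>x. \<bar>x\<bar> powr (2 * s + 2)) has_real_derivative (2 * s + 2) * (\<bar>x\<bar> powr (2 * s) * x)) (at x)"
proof -
  have powr: "\<bar>z\<bar> powr (2 * s + 2) = \<bar>z\<bar> powr (2 * s) * z * z" for z :: real
    using assms by (cases "z = 0") (auto simp: powr_add power2_eq_square)
  consider "x = 0" | "x > 0" | "x < 0" by linarith
  then show ?thesis
  proof cases
    case 1
    have "isCont (\<lambda>z::real. \<bar>z\<bar> powr (2 * s) * z) 0"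
      using assms by (intro continuous_intros) auto
    then show ?thesis
      unfolding 1 CARAT_DERIV
      by (intro exI[of _ "\<lambda>z. \<bar>z\<bar> powr (2 * s) * z"] conjI allI) (simp_all add: powr)
  next
    case 2
    have "((\<lambda>x. x powr (2 * s + 2)) has_real_derivative (2 * s + 2) * (\<bar>x\<bar> powr (2 * s) * x)) (at x)"
      using 2 by (auto intro!: derivative_eq_intros simp: powr_add powr_diff power2_eq_square field_simps)
    then show ?thesis
      by (rule has_field_derivative_transform_within_open[of _ _ _ "{0<..}"]) (use 2 in auto)
  next
    case 3
    have "((\<lambda>x. (-x) powr (2 * s + 2)) has_real_derivative (2 * s + 2) * (\<bar>x\<bar> powr (2 * s) * x)) (at x)"
      using 3 by (auto intro!: derivative_eq_intros simp: powr_add powr_diff power2_eq_square field_simps)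
    then show ?thesis
      by (rule has_field_derivative_transform_within_open[of _ _ _ "{..<0}"]) (use 3 in auto)
  qed
qed

section \<open>Conservation of energy and absence of zeros\<close>

lemma jet_solves_continuous: "jet_solves l m g u \<Longrightarrow> continuous_on A (u 0)"
  by (rule DERIV_continuous_on, rule has_field_derivative_at_within, erule jet_solvesD(1))

text \<open>The derivative of this energy is \<open>u'\<close> times the difference of the two sides
  of the equation, so it is constant; decay makes the constant 0.\<close>

lemma energy_zero:
  assumes "0 < s" and sol: "jet_solves l m (\<lambda>t. \<bar>u 0 t\<bar> powr (2 * s) * u 0 t) u" and dec: "decays u"
  shows "u 1 t * u 3 t - (u 2 t)\<^sup>2 / 2 - (l + m) * (u 1 t)\<^sup>2 / 2 + l * m * (u 0 t)\<^sup>2 / 2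
    - \<bar>u 0 t\<bar> powr (2 * s + 2) / (2 * s + 2) = 0"
proof (rule decays_first_integral_zero[where t = t and E = "\<lambda>t. u 1 t * u 3 t - (u 2 t)\<^sup>2 / 2
    - (l + m) * (u 1 t)\<^sup>2 / 2 + l * m * (u 0 t)\<^sup>2 / 2 - \<bar>u 0 t\<bar> powr (2 * s + 2) / (2 * s + 2)"])
  fix t
  define P where "P t = \<bar>u 0 t\<bar> powr (2 * s + 2) / (2 * s + 2)" for t
  have "(P has_real_derivative \<bar>u 0 t\<bar> powr (2 * s) * u 0 t * u 1 t) (at t)"
    unfolding P_def
    by (rule DERIV_cong[OF DERIV_cdivide[OF DERIV_chain2[OF DERIV_abs_powr[OF assms(1)]
        jet_solvesD(1)[OF sol]]]]) (use assms(1) in \<open>simp add: field_simps\<close>)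
  then show "((\<lambda>t. u 1 t * u 3 t - (u 2 t)\<^sup>2 / 2 - (l + m) * (u 1 t)\<^sup>2 / 2 + l * m * (u 0 t)\<^sup>2 / 2
    - \<bar>u 0 t\<bar> powr (2 * s + 2) / (2 * s + 2)) has_real_derivative 0) (at t)"
    unfolding P_def[symmetric]
    by (auto intro!: derivative_eq_intros jet_solvesD[OF sol] simp: algebra_simps)
next
  have "((\<lambda>t. \<bar>u 0 t\<bar> powr (2 * s + 2)) \<longlongrightarrow> 0) at_infinity"
    using assms(1) by (intro tendsto_zero_powrI[OF _ tendsto_const] tendsto_rabs_zero decaysD[OF dec]) auto
  then show "((\<lambda>t. u 1 t * u 3 t - (u 2 t)\<^sup>2 / 2 - (l + m) * (u 1 t)\<^sup>2 / 2 + l * m * (u 0 t)\<^sup>2 / 2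
    - \<bar>u 0 t\<bar> powr (2 * s + 2) / (2 * s + 2)) \<longlongrightarrow> 0) at_infinity"
    using assms(1) by (auto intro!: tendsto_eq_intros decaysD[OF dec])
qed

text \<open>At a zero of \<open>u 0\<close> the energy identity forces the jet, or its reflection,
  into the cone or its negative. The jet is then zero, and unique continuation makes
  \<open>u 0\<close> vanish everywhere.\<close>

lemma nonlinear_nonvanishing:
  assumes l: "0 < l" "l \<le> m" and s: "0 < s"
    and sol: "jet_solves l m (\<lambda>t. \<bar>u 0 t\<bar> powr (2 * s) * u 0 t) u" and dec: "decays u"
    and nontriv: "u 0 b \<noteq> 0"
  shows "u 0 a \<noteq> 0"
proof
  assume zero: "u 0 a = 0"
  obtain B where B: "B > 0" "\<And>t. \<bar>u 0 t\<bar> \<le> B"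
    using decaying_bounded[OF jet_solves_continuous[OF sol] decaysD(1)[OF dec]] by blast
  \<comment> \<open>The nonlinear term is read as \<open>c t * u 0 t\<close>, so that
    \<open>u\<close> solves a linear equation with bounded nonnegative coefficient.\<close>
  define c where "c t = \<bar>u 0 t\<bar> powr (2 * s)" for t
  define M where "M = B powr (2 * s)"
  have c: "0 \<le> c t" "c t \<le> M" for t
    using B s by (auto simp: c_def M_def powr_mono2)
  have sol_c: "jet_solves l m (\<lambda>t. c t * u 0 t) u" using sol by (simp add: c_def)
  have sol_r: "jet_solves l m (\<lambda>t. c (2 * a - t) * reflect a u 0 t) (reflect a u)"
    using jet_solves_reflect[OF sol_c, of a] by (simp add: reflect_def)
  have m: "0 < m" using l by simp
  note cone = decays_homogeneous_cone_trivial[OF l(1) m c sol_c dec, of a a]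
  note cone_r = decays_homogeneous_cone_trivial[where c = "\<lambda>t. c (2 * a - t)",
      OF l(1) m c(1) c(2) sol_r decays_reflect[OF dec], of a a]
  have "u 1 a * u 3 a - (u 2 a)\<^sup>2 / 2 - (l + m) * (u 1 a)\<^sup>2 / 2 = 0"
    using energy_zero[OF s sol dec, of a] zero s by simp
  \<comment> \<open>Since \<open>l\<close> is the smaller root, the right-hand side is nonnegative,
    so \<open>u 1 a\<close> and \<open>u 3 a - l * u 1 a\<close> cannot have opposite signs.\<close>
  then have "u 1 a * (u 3 a - l * u 1 a) = (u 2 a)\<^sup>2 / 2 + (m - l) / 2 * (u 1 a)\<^sup>2"
    by (simp add: field_simps power2_eq_square)
  moreover have "0 \<le> (m - l) / 2 * (u 1 a)\<^sup>2" using l by simp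
  ultimately have e: "(u 2 a)\<^sup>2 / 2 \<le> u 1 a * (u 3 a - l * u 1 a)" by linarith
  then have w: "0 \<le> u 1 a * (u 3 a - l * u 1 a)"
    using zero_le_power2[of "u 2 a"] by linarith
  have "u k a = 0" if k: "k < 4" for k
  \<comment> \<open>If \<open>u 1 a = 0\<close>, only \<open>u 3 a\<close> can be nonzero. Otherwise
    the sign of \<open>u 2 a\<close> decides whether the cone argument runs forward or in reversed
    time, where the odd-order entries change sign.\<close>
  proof (cases "u 1 a" "0 :: real" rule: linorder_cases)
    case equal
    then have "u 2 a = 0" using e by simp
    then show ?thesis
      using cone[OF _ order_refl k] equal zero by (cases "0 \<le> u 3 a") auto
  next
    case less
    then have "u 3 a - l * u 1 a \<le> 0" using w by (simp add: zero_le_mult_iff)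
    then show ?thesis
      using cone[OF _ order_refl k] cone_r[OF _ order_refl k] less zero
      by (cases "0 \<le> u 2 a") (auto simp: reflect_def)
  next
    case greater
    then have "0 \<le> u 3 a - l * u 1 a" using w by (simp add: zero_le_mult_iff)
    then show ?thesis
      using cone[OF _ order_refl k] cone_r[OF _ order_refl k] greater zero
      by (cases "0 \<le> u 2 a") (auto simp: reflect_def)
  qed
  then have "u 0 b = 0"
    using linear_unique_continuation[OF l(1) m c sol_c dec] by blast
  then show False using nontriv by simp
qed

text \<open>The last entry is \<open>u''''\<close> expressed through the equation, because
  \<open>jet_solves\<close> constrains \<open>u k\<close> for \<open>k \<le> 3\<close> only.\<close>

lemma jet_solves_derivative:
  assumes sol: "jet_solves l m g u" and g: "\<And>t. (g has_real_derivative h t) (at t)"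
  shows "jet_solves l m h
    (\<lambda>k t. if k < 3 then u (Suc k) t else (l + m) * u 2 t - l * m * u 0 t + g t)"
  using jet_solvesD[OF sol]
  by (intro jet_solvesI)
    (auto simp: eval_nat_numeral One_nat_def algebra_simps intro!: derivative_eq_intros g)

lemma decays_derivative:
  assumes dec: "decays u" and g: "(g \<longlongrightarrow> 0) at_infinity"
  shows "decays (\<lambda>k t. if k < 3 then u (Suc k) t else (l + m) * u 2 t - l * m * u 0 t + g t)"
proof -
  have "((\<lambda>t. (l + m) * u 2 t - l * m * u 0 t + g t) \<longlongrightarrow> 0) at_infinity"
    by (auto intro!: tendsto_eq_intros decaysD[OF dec] g)
  then show ?thesis using dec unfolding decays_def by (auto simp: less_Suc_eq eval_nat_numeral One_nat_def)
qed

text \<open>The slope comes from the mean value theorem. It turns the difference of two positive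
  solutions of the nonlinear equation into a solution of a linear one with bounded nonnegative
  coefficient.\<close>

lemma powr_secant:
  fixes x y B p :: real
  assumes "0 < x" "x \<le> B" "0 < y" "y \<le> B" "1 \<le> p"
  shows "\<exists>c. 0 \<le> c \<and> c \<le> p * B powr (p - 1) \<and> x powr p - y powr p = c * (x - y)"
  using assms
proof (induction x y rule: linorder_wlog)
  case (le x y)
  show ?case
  proof (cases "x = y")
    case True
    then show ?thesis using le by (intro exI[of _ 0]) auto
  next
    case False
    have "DERIV (\<lambda>z. z powr p) z :> p * z powr (p - 1)" if "x \<le> z" for z
      using le that by (intro has_real_derivative_powr) auto
    with MVT2[of x y "\<lambda>z. z powr p" "\<lambda>z. p * z powr (p - 1)"] False le
    obtain z where z: "x < z" "z < y" "y powr p - x powr p = (y - x) * (p * z powr (p - 1))"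
      by auto
    have "z powr (p - 1) \<le> B powr (p - 1)" using z le by (intro powr_mono2) auto
    then show ?thesis
      using z le by (intro exI[of _ "p * z powr (p - 1)"]) (auto simp: algebra_simps)
  qed
next
  case (sym x y)
  then obtain c where "0 \<le> c" "c \<le> p * B powr (p - 1)" "y powr p - x powr p = c * (y - x)" by auto
  then show ?case by (intro exI[of _ c]) (auto simp: algebra_simps)
qed

lemma DERIV_powr_times:
  fixes f :: "real \<Rightarrow> real"
  assumes "(f has_real_derivative f') (at t)" "0 < f t"
  shows "((\<lambda>t. f t powr (2 * s) * f t) has_real_derivative (2 * s + 1) * f t powr (2 * s) * f') (at t)"
proof -
  have "((\<lambda>x. x powr (2 * s) * x) has_real_derivative (2 * s + 1) * f t powr (2 * s)) (at (f t))"
    using assms(2) by (auto intro!: derivative_eq_intros simp: powr_diff field_simps)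
  from DERIV_chain2[OF this assms(1)] show ?thesis .
qed

text \<open>This is the energy of \<open>u\<close> differentiated in the direction \<open>v\<close>.
  It is constant by the two equations and tends to 0.\<close>

lemma linear_energy_zero:
  assumes "0 < s" and sol: "jet_solves l m (\<lambda>t. u 0 t powr (2 * s) * u 0 t) u" and dec: "decays u"
    and pos: "\<And>t. 0 < u 0 t"
    and sol_v: "jet_solves l m (\<lambda>t. (2 * s + 1) * u 0 t powr (2 * s) * v 0 t) v" and dec_v: "decays v"
  shows "u 1 t * v 3 t + v 1 t * u 3 t - u 2 t * v 2 t - (l + m) * (u 1 t * v 1 t)
    + l * m * (u 0 t * v 0 t) - u 0 t powr (2 * s) * u 0 t * v 0 t = 0"
proof (rule decays_first_integral_zero[where t = t and E = "\<lambda>t. u 1 t * v 3 t + v 1 t * u 3 t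
    - u 2 t * v 2 t - (l + m) * (u 1 t * v 1 t) + l * m * (u 0 t * v 0 t)
    - u 0 t powr (2 * s) * u 0 t * v 0 t"])
  fix t
  define P where "P t = u 0 t powr (2 * s) * u 0 t" for t
  define Q where "Q t = u 0 t powr (2 * s)" for t
  have P: "(P has_real_derivative (2 * s + 1) * Q t * u 1 t) (at t)"
    unfolding P_def Q_def by (rule DERIV_powr_times[OF jet_solvesD(1)[OF sol] pos])
  note sol' = jet_solvesD[OF sol, folded P_def] jet_solvesD[OF sol_v, folded Q_def]
  show "((\<lambda>t. u 1 t * v 3 t + v 1 t * u 3 t
    - u 2 t * v 2 t - (l + m) * (u 1 t * v 1 t) + l * m * (u 0 t * v 0 t)
    - u 0 t powr (2 * s) * u 0 t * v 0 t) has_real_derivative 0) (at t)"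
    unfolding P_def[symmetric]
    by (auto intro!: derivative_eq_intros P sol') (auto simp: algebra_simps)
next
  define Q where "Q t = u 0 t powr (2 * s)" for t
  have "(Q \<longlongrightarrow> 0) at_infinity"
    unfolding Q_def using assms(1) pos
    by (intro tendsto_zero_powrI[OF _ tendsto_const] decaysD[OF dec]) (auto simp: less_imp_le)
  then show "((\<lambda>t. u 1 t * v 3 t + v 1 t * u 3 t
    - u 2 t * v 2 t - (l + m) * (u 1 t * v 1 t) + l * m * (u 0 t * v 0 t)
    - u 0 t powr (2 * s) * u 0 t * v 0 t) \<longlongrightarrow> 0) at_infinity"
    unfolding Q_def[symmetric]
    by (auto intro!: tendsto_eq_intros decaysD[OF dec] decaysD[OF dec_v])
qed

text \<open>All terms of the energy that contain \<open>u'\<close> drop out, which leaves an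
  equation for \<open>u''\<close>.\<close>

lemma positive_energy_at_critical_point:
  assumes s: "0 < s"
    and sol: "jet_solves l m (\<lambda>t. u 0 t powr (2 * s) * u 0 t) u" and dec: "decays u"
    and pos: "\<And>t. 0 < u 0 t" and crit: "u 1 a = 0"
  shows "(u 2 a)\<^sup>2 = l * m * (u 0 a)\<^sup>2 - u 0 a powr (2 * s) * (u 0 a)\<^sup>2 / (s + 1)"
proof -
  have "jet_solves l m (\<lambda>t. \<bar>u 0 t\<bar> powr (2 * s) * u 0 t) u"
    using sol pos by (simp add: abs_of_pos)
  from energy_zero[OF s this dec, of a]
  have "(u 2 a)\<^sup>2 / 2 = l * m * (u 0 a)\<^sup>2 / 2 - u 0 a powr (2 * s) * (u 0 a)\<^sup>2 / (2 * (s + 1))"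
    using pos[of a] crit by (simp add: powr_add)
  moreover have "u 0 a powr (2 * s) * (u 0 a)\<^sup>2 / (2 * (s + 1))
      = (u 0 a powr (2 * s) * (u 0 a)\<^sup>2 / (s + 1)) / 2" by simp
  ultimately have "(u 2 a)\<^sup>2 / 2 = (l * m * (u 0 a)\<^sup>2 - u 0 a powr (2 * s) * (u 0 a)\<^sup>2 / (s + 1)) / 2"
    by (simp only: diff_divide_distrib)
  then show ?thesis by simp
qed

lemma positive_peak:
  assumes l: "0 < l" "0 < m" and s: "0 < s"
    and sol: "jet_solves l m (\<lambda>t. u 0 t powr (2 * s) * u 0 t) u" and dec: "decays u"
    and pos: "\<And>t. 0 < u 0 t"
  obtains a where "\<And>t. u 0 (2 * a - t) = u 0 t" "u 1 a = 0" "u 2 a < 0" "u 3 a = 0"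
proof -
  obtain a where max: "\<And>t. u 0 t \<le> u 0 a"
    using decaying_attains_max[OF jet_solves_continuous[OF sol] decaysD(1)[OF dec] pos[of 0]] by blast
  define B where "B = u 0 a"
  define M where "M = (2 * s + 1) * B powr (2 * s)"
  have B: "0 < B" "u 0 t \<le> B" for t using pos max by (auto simp: B_def)
  have u1: "u 1 a = 0"
    by (rule DERIV_local_max[OF jet_solvesD(1)[OF sol], of 1]) (use max in auto)

  \<comment> \<open>At \<open>a\<close> the even-order entries of \<open>d\<close> cancel and
    \<open>d 1 a = 2 * u 1 a = 0\<close>, so only \<open>d 3 a\<close> can be nonzero and the cone
    argument applies.\<close>
  define d where "d = (\<lambda>k t. 1 * u k t + (-1) * reflect a u k t)"
  have "\<exists>c. 0 \<le> c \<and> c \<le> M \<and>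
      u 0 t powr (2 * s) * u 0 t - u 0 (2 * a - t) powr (2 * s) * u 0 (2 * a - t) = c * d 0 t" for t
    using powr_secant[of "u 0 t" B "u 0 (2 * a - t)" "2 * s + 1"] B pos s
    by (auto simp: powr_add M_def d_def reflect_def less_imp_le)
  then obtain c where c: "\<And>t. 0 \<le> c t" "\<And>t. c t \<le> M"
    "\<And>t. u 0 t powr (2 * s) * u 0 t - u 0 (2 * a - t) powr (2 * s) * u 0 (2 * a - t) = c t * d 0 t"
    by metis
  have "jet_solves l m (\<lambda>t. c t * d 0 t) d"
    using jet_solves_lincomb[OF sol jet_solves_reflect[OF sol, of a], of 1 "-1"]
    unfolding d_def[symmetric] by (simp add: c)
  moreover have "decays d" unfolding d_def by (intro decays_lincomb decays_reflect dec)
  ultimately have d: "d k t = 0" if "a \<le> t" "k < 4" for k t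
    by (rule decays_homogeneous_cone_trivial[OF l c(1,2), where a = a])
      (use that u1 in \<open>auto simp: d_def reflect_def\<close>)
  have even: "u 0 (2 * a - t) = u 0 t" for t
    using d[of t 0] d[of "2 * a - t" 0] by (cases "a \<le> t") (auto simp: d_def reflect_def)
  have u3: "u 3 a = 0" using d[of a 3] by (simp add: d_def reflect_def)

  have "\<not> 0 < u 2 a"
  proof
    assume "0 < u 2 a"
    then obtain r where r: "r > 0" "\<And>h. 0 < h \<Longrightarrow> h < r \<Longrightarrow> 0 < u 1 (a + h)"
      using DERIV_pos_inc_right[OF jet_solvesD(2)[OF sol, of a]] u1 by auto
    obtain z where z: "a < z" "z < a + r / 2" "u 0 (a + r / 2) - u 0 a = (a + r / 2 - a) * u 1 z"
      using MVT2[of a "a + r / 2" "u 0" "u 1"] jet_solvesD(1)[OF sol] r by auto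
    have "0 < u 1 z" using r(2)[of "z - a"] z r(1) by simp
    then have "0 < (a + r / 2 - a) * u 1 z" using r(1) by simp
    then show False using z(3) max[of "a + r / 2"] by linarith
  qed
  moreover have "u 2 a \<noteq> 0"
  proof
    assume u2: "u 2 a = 0"
    define g where "g t = u 0 t powr (2 * s) * u 0 t" for t
    define w where "w = (\<lambda>k t. if k < 3 then u (Suc k) t else (l + m) * u 2 t - l * m * u 0 t + g t)"
    have "(g has_real_derivative ((2 * s + 1) * u 0 t powr (2 * s)) * u 1 t) (at t)" for t
      unfolding g_def by (rule DERIV_powr_times[OF jet_solvesD(1)[OF sol] pos])
    from jet_solves_derivative[OF sol[folded g_def] this]
    have sol_w: "jet_solves l m (\<lambda>t. ((2 * s + 1) * u 0 t powr (2 * s)) * w 0 t) w"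
      unfolding w_def by (simp add: One_nat_def)
    have "((\<lambda>t. u 0 t powr (2 * s)) \<longlongrightarrow> 0) at_infinity"
      using s pos
      by (intro tendsto_zero_powrI[OF _ tendsto_const] decaysD[OF dec]) (auto simp: less_imp_le)
    then have dec_w: "decays w" unfolding w_def g_def
      by (intro decays_derivative dec tendsto_mult_zero decaysD[OF dec])
    have w: "w 0 a = 0" "w 1 a = 0" "w 2 a = 0" "w 3 a = g a - l * m * u 0 a"
      using u1 u2 u3 by (auto simp: w_def eval_nat_numeral One_nat_def)
    \<comment> \<open>The jet of \<open>u'\<close> at \<open>a\<close> has at most this one nonzero
      entry, so it lies in the cone or its negative.\<close>
    have "w 3 a = 0"
    proof (rule decays_homogeneous_cone_trivial[OF l _ _ sol_w dec_w])
      show "(2 * s + 1) * u 0 t powr (2 * s) \<le> M" for t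
        unfolding M_def using B pos s by (intro mult_left_mono powr_mono2) (auto simp: less_imp_le)
    qed (use s w in auto)
    then have "g a = l * m * u 0 a" using w by simp
    then have A: "u 0 a powr (2 * s) * (u 0 a)\<^sup>2 = l * m * (u 0 a)\<^sup>2"
      by (simp add: g_def power2_eq_square flip: mult.assoc)
    define A where "A = l * m * (u 0 a)\<^sup>2"
    \<comment> \<open>The vanishing of \<open>u''''\<close> and the vanishing of the energy are two
      incompatible conditions on \<open>u 0 a\<close>: together they force \<open>A = 0\<close>,
      while \<open>A\<close> is positive.\<close>
    have "0 = A - A / (s + 1)"
      using positive_energy_at_critical_point[OF s sol dec pos u1] u2 unfolding A A_def by simp
    then have "A * s = 0" using s by (simp add: field_simps)
    then show False using l s pos[of a] by (simp add: A_def)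
  qed
  ultimately show ?thesis using that even u1 u3 by force
qed

subsection \<open>The linearized equation\<close>

text \<open>Evenness of \<open>v\<close> about \<open>a\<close> enters only as the vanishing of
  \<open>v'\<close> and \<open>v'''\<close> there. The cone argument gives a strict upper bound for
  \<open>v''\<close> at \<open>a\<close> that contradicts the two energy identities.\<close>

lemma even_linear_solution_at_peak_not_pos:
  assumes l: "0 < l" "0 < m" and s: "0 < s"
    and sol: "jet_solves l m (\<lambda>t. u 0 t powr (2 * s) * u 0 t) u" and dec: "decays u"
    and pos: "\<And>t. 0 < u 0 t" and bound: "\<And>t. u 0 t \<le> B"
    and peak: "u 1 a = 0" "u 2 a < 0" "u 3 a = 0"
    and sol_v: "jet_solves l m (\<lambda>t. (2 * s + 1) * u 0 t powr (2 * s) * v 0 t) v" and dec_v: "decays v"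
    and v: "v 1 a = 0" "v 3 a = 0"
  shows "v 0 a \<le> 0"
proof (rule ccontr)
  assume "\<not> v 0 a \<le> 0"
  then have v0: "0 < v 0 a" by simp
  define k where "k = v 0 a / u 0 a"
  have k: "0 < k" "k * u 0 a = v 0 a" using v0 pos[of a] by (auto simp: k_def)
  define w where "w = (\<lambda>j t. 1 * v j t + (-k) * u j t)"
  \<comment> \<open>With \<open>f(x) = x powr (2 * s + 1)\<close> one has
    \<open>x f'(x) - f(x) = 2 s f(x)\<close>; this surplus, times \<open>k\<close>, is the positive
    forcing in the equation for \<open>w\<close>.\<close>
  define p where "p t = 2 * s * k * (u 0 t powr (2 * s) * u 0 t)" for t
  define h where "h t = (2 * s + 1) * u 0 t powr (2 * s)" for t
  have p: "0 < p t" for t using s k pos[of t] by (simp add: p_def)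
  have "(\<lambda>t. 1 * ((2 * s + 1) * u 0 t powr (2 * s) * v 0 t) + (-k) * (u 0 t powr (2 * s) * u 0 t))
      = (\<lambda>t. h t * w 0 t + p t)"
    by (auto simp: w_def p_def h_def algebra_simps)
  with jet_solves_lincomb[OF sol_v sol, of 1 "-k"]
  have sol_w: "jet_solves l m (\<lambda>t. h t * w 0 t + p t) w" by (simp add: w_def)
  have dec_w: "decays w" unfolding w_def by (intro decays_lincomb dec dec_v)
  have w: "w 0 a = 0" "w 1 a = 0" "w 3 a = 0" using k v peak by (auto simp: w_def)
  have h: "0 \<le> h t" "h t \<le> (2 * s + 1) * B powr (2 * s)" for t
    using s pos bound by (auto simp: h_def less_imp_le intro!: mult_left_mono powr_mono2)
  have "w 2 a < 0"
  proof (rule ccontr)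
    assume "\<not> w 2 a < 0"
    then have "p (a + 1) = 0"
      using w less_imp_le[OF p]
      by (intro decays_linear_cone_trivial(2)[where c = h and p = p and u = w and a = a, OF l h] sol_w dec_w)
        auto
    then show False using p[of "a + 1"] by simp
  qed
  then have "v 2 a < k * u 2 a" by (simp add: w_def)
  \<comment> \<open>Multiplication by \<open>u 2 a < 0\<close> reverses the inequality and produces
    the products that occur in the two energy identities.\<close>
  then have "k * u 2 a * u 2 a < v 2 a * u 2 a"
    using peak(2) by (rule mult_strict_right_mono_neg)
  then have "u 0 a * (k * u 2 a * u 2 a) < u 0 a * (u 2 a * v 2 a)"
    using pos[of a] by (simp add: mult.commute)
  also have "u 2 a * v 2 a = l * m * (u 0 a * v 0 a) - u 0 a powr (2 * s) * u 0 a * v 0 a"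
    using linear_energy_zero[OF s sol dec pos sol_v dec_v, of a] peak v by simp
  also have "u 0 a * (k * u 2 a * u 2 a) = v 0 a * (u 2 a)\<^sup>2"
    using k by (simp add: power2_eq_square algebra_simps)
  also have "(u 2 a)\<^sup>2 = l * m * (u 0 a)\<^sup>2 - u 0 a powr (2 * s) * (u 0 a)\<^sup>2 / (s + 1)"
    by (rule positive_energy_at_critical_point[OF s sol dec pos peak(1)])
  \<comment> \<open>The terms with \<open>l * m\<close> agree on both sides and cancel.\<close>
  finally have "v 0 a * (u 0 a powr (2 * s) * (u 0 a)\<^sup>2)
      < v 0 a * (u 0 a powr (2 * s) * (u 0 a)\<^sup>2 / (s + 1))"
    by (simp add: power2_eq_square algebra_simps)
  then have "u 0 a powr (2 * s) * (u 0 a)\<^sup>2 < u 0 a powr (2 * s) * (u 0 a)\<^sup>2 / (s + 1)"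
    using v0 by (simp only: mult_less_cancel_left_pos)
  moreover have "u 0 a powr (2 * s) * (u 0 a)\<^sup>2 / (s + 1) \<le> u 0 a powr (2 * s) * (u 0 a)\<^sup>2"
    using s by (simp add: pos_divide_le_eq distrib_left)
  ultimately show False by (meson not_less)
qed

lemma positive_nondegenerate:
  assumes l: "0 < l" "0 < m" and s: "0 < s"
    and sol: "jet_solves l m (\<lambda>t. u 0 t powr (2 * s) * u 0 t) u" and dec: "decays u"
    and pos: "\<And>t. 0 < u 0 t"
    and sol_v: "jet_solves l m (\<lambda>t. (2 * s + 1) * u 0 t powr (2 * s) * v 0 t) v" and dec_v: "decays v"
  shows "\<exists>c. \<forall>t. v 0 t = c * u 1 t"
proof -
  obtain a where even: "\<And>t. u 0 (2 * a - t) = u 0 t" and peak: "u 1 a = 0" "u 2 a < 0" "u 3 a = 0"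
    using positive_peak[OF l s sol dec pos] by blast
  obtain B where B: "0 < B" "\<And>t. \<bar>u 0 t\<bar> \<le> B"
    using decaying_bounded[OF jet_solves_continuous[OF sol] decaysD(1)[OF dec]] by blast
  then have bound: "u 0 t \<le> B" for t using abs_le_D1 by blast
  define h where "h t = (2 * s + 1) * u 0 t powr (2 * s)" for t
  define M where "M = (2 * s + 1) * B powr (2 * s)"
  have h: "0 \<le> h t" "h t \<le> M" for t
    using s pos bound by (auto simp: h_def M_def less_imp_le intro!: mult_left_mono powr_mono2)
  define w where "w = (\<lambda>k t. if k < 3 then u (Suc k) t
    else (l + m) * u 2 t - l * m * u 0 t + u 0 t powr (2 * s) * u 0 t)"
  have w0: "w 0 = u 1" by (simp add: w_def One_nat_def)
  have sol_w: "jet_solves l m (\<lambda>t. h t * w 0 t) w"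
    using jet_solves_derivative[OF sol DERIV_powr_times[OF jet_solvesD(1)[OF sol] pos]]
    unfolding w0 h_def unfolding w_def .
  have "((\<lambda>t. u 0 t powr (2 * s)) \<longlongrightarrow> 0) at_infinity"
    using s pos
    by (intro tendsto_zero_powrI[OF _ tendsto_const] decaysD[OF dec]) (auto simp: less_imp_le)
  then have dec_w: "decays w" unfolding w_def
    by (intro decays_derivative dec tendsto_mult_zero decaysD[OF dec])

  \<comment> \<open>The first derivative of \<open>u'\<close> at \<open>a\<close> is
    \<open>u 2 a < 0\<close>, so this multiple of \<open>u'\<close> can cancel
    \<open>v 1 a\<close>.\<close>
  define c where "c = v 1 a / u 2 a"
  define z where "z = (\<lambda>k t. 1 * v k t + (-c) * w k t)"
  have sol_z: "jet_solves l m (\<lambda>t. h t * z 0 t) z"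
    using jet_solves_lincomb[OF sol_v[folded h_def] sol_w, of 1 "-c"]
    by (simp add: z_def algebra_simps)
  have dec_z: "decays z" unfolding z_def by (intro decays_lincomb dec_v dec_w)
  have z1: "z 1 a = 0" using peak by (simp add: z_def c_def w_def eval_nat_numeral One_nat_def)

  \<comment> \<open>The coefficient \<open>h\<close> is even about \<open>a\<close>, so
    \<open>z\<close> and its reflection solve the same equation. The only entry of \<open>d\<close>
    at \<open>a\<close> that can be nonzero is \<open>d 3 a = 2 * z 3 a\<close>.\<close>
  define d where "d = (\<lambda>k t. 1 * z k t + (-1) * reflect a z k t)"
  have "jet_solves l m (\<lambda>t. h t * d 0 t) d"
    using jet_solves_lincomb[OF sol_z jet_solves_reflect[OF sol_z, of a], of 1 "-1"] even
    by (simp add: d_def h_def reflect_def algebra_simps)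
  moreover have "decays d" unfolding d_def by (intro decays_lincomb decays_reflect dec_z)
  ultimately have d: "d k t = 0" if "a \<le> t" "k < 4" for k t
    by (rule decays_homogeneous_cone_trivial[OF l h, where a = a])
      (use that z1 in \<open>auto simp: d_def reflect_def\<close>)
  have z3: "z 3 a = 0" using d[of a 3] by (simp add: d_def reflect_def)

  have "z 0 a \<le> 0"
    by (rule even_linear_solution_at_peak_not_pos[OF l s sol dec pos bound peak
          sol_z[unfolded h_def] dec_z z1 z3])
  moreover have "- z 0 a \<le> 0"
    using jet_solves_uminus[OF sol_z] decays_uminus[OF dec_z] z1 z3
    by (intro even_linear_solution_at_peak_not_pos[OF l s sol dec pos bound peak,
          where v = "\<lambda>k t. - z k t"]) (simp_all add: h_def)
  ultimately have "z 0 a = 0" by simp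
  \<comment> \<open>Only \<open>z 2 a\<close> can still be nonzero, so one of the two cones contains
    the jet.\<close>
  then have z: "z k t = 0" if "a \<le> t" "k < 4" for k t
    by (intro decays_homogeneous_cone_trivial[OF l h sol_z dec_z, where a = a])
      (use that z1 z3 in auto)
  have "z 0 t = 0" for t
    using linear_unique_continuation[OF l h sol_z dec_z] z[OF order_refl] by blast
  then have "\<forall>t. v 0 t = c * u 1 t" by (simp add: z_def w0)
  then show ?thesis by blast
qed

section \<open>Passage from iterated derivatives to jets, and the conclusion\<close>

lemma jet_solves_derivs:
  assumes u: "four_times_differentiable u"
    and eq: "\<And>t. (deriv ^^ 4) u t - (l + m) * (deriv ^^ 2) u t + l * m * u t = g t"
  shows "jet_solves l m g (\<lambda>k. (deriv ^^ k) u)"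
proof -
  have D: "((deriv ^^ k) u has_real_derivative (deriv ^^ Suc k) u t) (at t)" if "k < 4" for k t
    using u that unfolding four_times_differentiable_def
    by (auto simp: field_differentiable_derivI)
  have "(deriv ^^ Suc 3) u t = (l + m) * (deriv ^^ 2) u t - l * m * (deriv ^^ 0) u t + g t" for t
    using eq[of t] by (simp add: eval_nat_numeral One_nat_def)
  then show ?thesis
    unfolding jet_solves_def using D D[of 3] by auto
qed

lemma decays_derivs:
  assumes "homoclinic_to_zero u"
  shows "decays (\<lambda>k. (deriv ^^ k) u)"
proof -
  note lim = assms[unfolded homoclinic_to_zero_def]
  from tendsto_fst[OF lim] tendsto_fst[OF tendsto_snd[OF lim]]
    tendsto_fst[OF tendsto_snd[OF tendsto_snd[OF lim]]] tendsto_snd[OF tendsto_snd[OF tendsto_snd[OF lim]]]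
  show ?thesis unfolding decays_def all_less_4 by (simp add: One_nat_def)
qed

theorem theorem3p16:
  fixes \<alpha> \<beta> \<sigma> :: real and U v :: "real \<Rightarrow> real"
  assumes "\<alpha> > 0" and "\<sigma> > 0" and "\<beta> \<ge> 2 * sqrt \<alpha>"
    and "solves_nonlinear_eq \<alpha> \<beta> \<sigma> U" and "homoclinic_to_zero U" and "\<exists>t. U t \<noteq> 0"
    and "solves_linearized_eq \<alpha> \<beta> \<sigma> U v" and "homoclinic_to_zero v"
  shows "\<exists>c. \<forall>t. v t = c * deriv U t"
proof -
  \<comment> \<open>\<open>l\<close> and \<open>m\<close> are the roots of the characteristic
    polynomial in the squared exponent. They are real because
    \<open>\<beta> \<ge> 2 * sqrt \<alpha>\<close>, ordered because \<open>0 \<le> r\<close>, and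
    positive because \<open>r < \<beta>\<close>.\<close>
  define r where "r = sqrt (\<beta>\<^sup>2 - 4 * \<alpha>)"
  define l where "l = (\<beta> - r) / 2"
  define m where "m = (\<beta> + r) / 2"
  have \<beta>: "0 < \<beta>" using assms(1,3) using real_sqrt_gt_zero[OF assms(1)] by linarith
  have "(2 * sqrt \<alpha>)\<^sup>2 \<le> \<beta>\<^sup>2" using assms(1,3) by (intro power_mono) auto
  then have r: "0 \<le> r" "r\<^sup>2 = \<beta>\<^sup>2 - 4 * \<alpha>" using assms(1) by (auto simp: r_def power_mult_distrib)
  then have "r < \<beta>" using \<beta> assms(1) by (auto intro: power2_less_imp_less[of r \<beta>])
  then have l: "0 < l" "l \<le> m" "0 < m" using r \<beta> by (auto simp: l_def m_def)
  have "l + m = \<beta>" by (simp add: l_def m_def field_simps)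
  moreover have "l * m = \<alpha>" using r by (simp add: l_def m_def field_simps power2_eq_square)
  ultimately have lm: "\<beta> = l + m" "\<alpha> = l * m" by simp_all
  define u where "u k = (deriv ^^ k) U" for k
  define w where "w k = (deriv ^^ k) v" for k
  have 0: "u 0 = U" "w 0 = v" "u 1 = deriv U" by (simp_all add: u_def w_def One_nat_def)
  have sol: "jet_solves l m (\<lambda>t. \<bar>u 0 t\<bar> powr (2 * \<sigma>) * u 0 t) u"
    unfolding 0 unfolding u_def
    using assms(4) unfolding solves_nonlinear_eq_def lm by (intro jet_solves_derivs) auto
  have sol_w: "jet_solves l m (\<lambda>t. (2 * \<sigma> + 1) * \<bar>u 0 t\<bar> powr (2 * \<sigma>) * w 0 t) w"
    unfolding 0 unfolding w_def
    using assms(7) unfolding solves_linearized_eq_def lm by (intro jet_solves_derivs) auto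
  have dec: "decays u" "decays w"
    unfolding u_def w_def using assms(5,8) by (auto intro: decays_derivs)
  have nz: "u 0 t \<noteq> 0" for t
    using nonlinear_nonvanishing[OF l(1,2) assms(2) sol dec(1)] assms(6) 0 by auto
  have cont: "continuous_on A (u 0)" for A by (rule jet_solves_continuous[OF sol])
  have conn: "connected (range (u 0))" by (intro connected_continuous_image cont) auto
  have "\<not> (u 0 x < 0 \<and> 0 < u 0 y)" for x y
  proof
    assume "u 0 x < 0 \<and> 0 < u 0 y"
    then have "0 \<in> range (u 0)" by (auto intro: connectedD_interval[OF conn, of "u 0 x" "u 0 y"])
    then show False using nz by force
  qed
  then have sign: "(\<forall>t. 0 < u 0 t) \<or> (\<forall>t. 0 < - u 0 t)"
    using nz by (metis linorder_neqE_linordered_idom neg_0_less_iff_less)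
  from sign have "\<exists>c. \<forall>t. w 0 t = c * u 1 t"
  proof
    assume pos: "\<forall>t. 0 < u 0 t"
    then show ?thesis
      using positive_nondegenerate[OF l(1,3) assms(2) _ dec(1) _ _ dec(2)] sol sol_w
      by (simp add: abs_of_pos)
  next
    \<comment> \<open>The linearized equation depends on \<open>U\<close> only through its absolute
      value, so \<open>-U\<close> replaces \<open>U\<close>; the sign is absorbed into
      \<open>c\<close>.\<close>
    assume pos: "\<forall>t. 0 < - u 0 t"
    then have "\<exists>c. \<forall>t. w 0 t = c * - u 1 t"
      using jet_solves_uminus[OF sol] sol_w
      by (intro positive_nondegenerate[OF l(1,3) assms(2) _ decays_uminus[OF dec(1)] _ _ dec(2)])
        (simp_all add: abs_of_neg)
    then show ?thesis by (metis minus_mult_commute)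
  qed
  then show ?thesis unfolding 0 .
qed

end
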